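(* Let $\Omega=\{1,\dots,K\}$ and suppose $g:2^\Omega\to\mathbb{R}_+$ satisfies the submodular property $g(S)+g(T)\ge g(S\cap T)+g(S\cup T)$ for all $S,T\subseteq\Omega$. Let $\mathcal{P}(g)=\{\mathbf{r}\in\mathbb{R}_+^K:\ \sum_{i\in S}r_i\le g(S)\ \ \forall S\subseteq\Omega\}$. Then the vector $\mathbf{r}$ returned by the max-min algorithm (defined in the context) applied to $(\Omega,g)$ is the max-min fair vector of $\mathcal{P}(g)$.
   Context: $\mathbb{R}_+$ denotes the nonnegative reals. A point $\mathbf{r}^{MM}\in\mathcal{R}$ of a set $\mathcal{R}\subseteq\mathbb{R}_+^K$ is max-min fair in $\mathcal{R}$ if for every $\mathbf{r}\in\mathcal{R}$ and every $i$ with $r_i>r_i^{MM}$ there is $j\in\Omega$ with $r_j<r_j^{MM}\le r_i^{MM}$. Max-min algorithm on input $(\Omega,g)$, with $\Omega$ a nonempty finite set: choose a nonempty subset $S_0\subseteq\Omega$ attaining $\min_{\emptyset\ne S\subseteq\Omega} g(S)/|S|$ and set $r_i:=g(S_0)/|S_0|$ for all $i\in S_0$. If $S_0\neq\Omega$, the remaining components $r_i$, $i\in\Omega':=\Omega\setminus S_0$, are obtained by recursively applying the same procedure to $(\Omega',g')$, where $g'(S):=g(S\cup S_0)-g(S_0)$ for $S\subseteq\Omega'$. *)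

theory Defs
  imports Complex_Main "HOL-Library.FuncSet"
begin

text \<open>
  Vectors indexed by a set \<open>\<Omega>\<close> are functions that are extensional on \<open>\<Omega>\<close>, so
  that equality of functions is equality of vectors.
\<close>

definition polyhedron :: "'a set \<Rightarrow> ('a set \<Rightarrow> real) \<Rightarrow> ('a \<Rightarrow> real) set" where
  "polyhedron \<Omega> g = {r \<in> \<Omega> \<rightarrow>\<^sub>E {0..}. \<forall>S\<subseteq>\<Omega>. (\<Sum>i\<in>S. r i) \<le> g S}"

definition max_min_fair :: "'a set \<Rightarrow> ('a \<Rightarrow> real) set \<Rightarrow> ('a \<Rightarrow> real) \<Rightarrow> bool" where
  "max_min_fair \<Omega> R q \<longleftrightarrow> q \<in> R \<and>
     (\<forall>r\<in>R. \<forall>i\<in>\<Omega>. r i > q i \<longrightarrow> (\<exists>j\<in>\<Omega>. r j < q j \<and> q j \<le> q i))"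

text \<open>
  The algorithm chooses freely among the minimizers, so it is modelled as a relation:
  \<open>max_min_algorithm \<Omega> g r\<close> holds iff some sequence of admissible choices makes the
  algorithm return \<open>r\<close>.
\<close>

inductive max_min_algorithm :: "'a set \<Rightarrow> ('a set \<Rightarrow> real) \<Rightarrow> ('a \<Rightarrow> real) \<Rightarrow> bool" where
  stop: "\<lbrakk>finite \<Omega>; is_arg_min (\<lambda>S. g S / real (card S)) (\<lambda>S. S \<noteq> {} \<and> S \<subseteq> \<Omega>) S\<^sub>0; S\<^sub>0 = \<Omega>\<rbrakk>
    \<Longrightarrow> max_min_algorithm \<Omega> g (\<lambda>i\<in>\<Omega>. g S\<^sub>0 / real (card S\<^sub>0))"
| recurse: "\<lbrakk>finite \<Omega>; is_arg_min (\<lambda>S. g S / real (card S)) (\<lambda>S. S \<noteq> {} \<and> S \<subseteq> \<Omega>) S\<^sub>0; S\<^sub>0 \<noteq> \<Omega>;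
      max_min_algorithm (\<Omega> - S\<^sub>0) (\<lambda>S. g (S \<union> S\<^sub>0) - g S\<^sub>0) r'\<rbrakk>
    \<Longrightarrow> max_min_algorithm \<Omega> g (\<lambda>i\<in>\<Omega>. if i \<in> S\<^sub>0 then g S\<^sub>0 / real (card S\<^sub>0) else r' i)"

lemma max_min_algorithm_total:
  assumes "finite \<Omega>" "\<Omega> \<noteq> {}"
  shows "\<exists>r. max_min_algorithm \<Omega> g r"
  using assms
proof (induction \<Omega> arbitrary: g rule: finite_psubset_induct)
  case (psubset \<Omega>)
  let ?A = "{S. S \<noteq> {} \<and> S \<subseteq> \<Omega>}"
  have "finite ?A"
    using psubset.hyps by (auto intro: finite_subset[of _ "Pow \<Omega>"])
  moreover have "?A \<noteq> {}"
    using psubset.prems by blast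
  ultimately obtain S where
    S: "is_arg_min (\<lambda>S. g S / real (card S)) (\<lambda>S. S \<noteq> {} \<and> S \<subseteq> \<Omega>) S"
    using ex_is_arg_min_if_finite[of ?A "\<lambda>S. g S / real (card S)"] by auto
  then have "S \<noteq> {}" "S \<subseteq> \<Omega>"
    by (auto simp: is_arg_min_def)
  show ?case
  proof (cases "S = \<Omega>")
    case True
    then show ?thesis
      using max_min_algorithm.stop[OF psubset.hyps(1) S] by blast
  next
    case False
    then have "\<Omega> - S \<subset> \<Omega>" "\<Omega> - S \<noteq> {}"
      using \<open>S \<noteq> {}\<close> \<open>S \<subseteq> \<Omega>\<close> by auto
    then obtain r' where "max_min_algorithm (\<Omega> - S) (\<lambda>T. g (T \<union> S) - g S) r'"
      using psubset.IH by blast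
    then show ?thesis
      using max_min_algorithm.recurse[OF psubset.hyps(1) S False] by blast
  qed
qed

end

theory Submission
  imports Defs
begin

text \<open>
  Let \<open>S\<^sub>0\<close> be the first minimizer and \<open>m = g S\<^sub>0 / |S\<^sub>0|\<close>. Minimality of \<open>m\<close> gives
  \<open>g (S \<union> S\<^sub>0) - g S\<^sub>0 \<ge> m |S|\<close>, so the rates assigned by later steps are at least \<open>m\<close>.
  Feasibility of the output on \<open>S\<close> splits into the parts \<open>S \<inter> S\<^sub>0\<close> and \<open>S - S\<^sub>0\<close>, which
  submodularity recombines. For fairness, the constraint at \<open>S\<^sub>0\<close> is tight: a competing
  vector either falls below \<open>m\<close> somewhere on \<open>S\<^sub>0\<close>, or sums to exactly \<open>g S\<^sub>0\<close> on \<open>S\<^sub>0\<close> and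
  then restricts to a feasible vector of the contracted problem.
\<close>

lemma polyhedronD:
  "r \<in> polyhedron \<Omega> g \<Longrightarrow> S \<subseteq> \<Omega> \<Longrightarrow> sum r S \<le> g S"
  by (simp add: polyhedron_def)

lemma max_min_fair_mem:
  "max_min_fair \<Omega> R q \<Longrightarrow> q \<in> R"
  by (simp add: max_min_fair_def)

text \<open>Among the coordinates where \<open>p\<close> and \<open>q\<close> differ, take
  \<open>j\<close> with \<open>min (p j) (q j)\<close> least. Fairness of the vector that is smaller
  at \<open>j\<close> yields a \<open>k\<close> where it exceeds the other and is at most its own
  value at \<open>j\<close>; so \<open>p\<close> and \<open>q\<close> also differ at
  \<open>k\<close>, with a smaller minimum.\<close>

lemma max_min_fair_unique:
  assumes "finite \<Omega>" "R \<subseteq> extensional \<Omega>"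
    and p: "max_min_fair \<Omega> R p" and q: "max_min_fair \<Omega> R q"
  shows "p = q"
proof (rule ccontr)
  assume "p \<noteq> q"
  let ?D = "{i \<in> \<Omega>. p i \<noteq> q i}"
  have pq: "p \<in> R" "q \<in> R"
    using p q by (auto dest: max_min_fair_mem)
  then have "?D \<noteq> {}"
    using \<open>p \<noteq> q\<close> assms(2) extensionalityI[of p \<Omega> q] by blast
  then obtain j where j: "j \<in> ?D" "\<And>k. k \<in> ?D \<Longrightarrow> min (p j) (q j) \<le> min (p k) (q k)"
    using ex_is_arg_min_if_finite[of ?D "\<lambda>i. min (p i) (q i)"] \<open>finite \<Omega>\<close>
    by (auto simp: is_arg_min_linorder)
  \<comment> \<open>Stated for \<open>u\<close> and \<open>v\<close> to cover both orders at
    \<open>j\<close>; \<open>u\<close> is the vector that is smaller there.\<close>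
  have no_smaller: False
    if fair: "max_min_fair \<Omega> R u" "v \<in> R" "u j < v j"
      and min_j: "\<And>k. k \<in> \<Omega> \<Longrightarrow> u k \<noteq> v k \<Longrightarrow> min (u j) (v j) \<le> min (u k) (v k)" for u v
  proof -
    obtain k where "k \<in> \<Omega>" "v k < u k" "u k \<le> u j"
      using fair j(1) unfolding max_min_fair_def by blast
    then show False
      using fair(3) min_j[of k] by auto
  qed
  show False
  proof (cases "p j < q j")
    case True
    then show False
      using no_smaller[OF p pq(2)] j(2) by auto
  next
    case False
    then have "q j < p j"
      using j(1) by auto
    then show False
      using no_smaller[OF q pq(1)] j(2) by (auto simp: min.commute)
  qed
qed

lemma average_arg_minD:
  fixes g :: "'a set \<Rightarrow> real"
  assumes "finite \<Omega>"
    and "is_arg_min (\<lambda>S. g S / real (card S)) (\<lambda>S. S \<noteq> {} \<and> S \<subseteq> \<Omega>) S\<^sub>0"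
  shows "S\<^sub>0 \<noteq> {}" "S\<^sub>0 \<subseteq> \<Omega>" "0 < card S\<^sub>0"
    and "\<And>S. S \<noteq> {} \<Longrightarrow> S \<subseteq> \<Omega> \<Longrightarrow> g S\<^sub>0 / real (card S\<^sub>0) * real (card S) \<le> g S"
proof -
  show S0: "S\<^sub>0 \<noteq> {}" "S\<^sub>0 \<subseteq> \<Omega>"
    using assms(2) by (auto simp: is_arg_min_def)
  then show "0 < card S\<^sub>0"
    using \<open>finite \<Omega>\<close> by (auto simp: card_gt_0_iff intro: finite_subset)
  fix S assume S: "S \<noteq> {}" "S \<subseteq> \<Omega>"
  then have "0 < card S"
    using \<open>finite \<Omega>\<close> by (auto simp: card_gt_0_iff intro: finite_subset)
  moreover have "g S\<^sub>0 / real (card S\<^sub>0) \<le> g S / real (card S)"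
    using assms(2) S by (auto simp: is_arg_min_linorder)
  ultimately show "g S\<^sub>0 / real (card S\<^sub>0) * real (card S) \<le> g S"
    by (simp add: pos_le_divide_eq)
qed

text \<open>The average bound is applied to \<open>S \<union> S\<^sub>0\<close> rather than
  \<open>S\<close>: by disjointness the cardinalities add up, and the share of
  \<open>S\<^sub>0\<close> is exactly \<open>g S\<^sub>0\<close>.\<close>

lemma contraction_ge:
  fixes g :: "'a set \<Rightarrow> real"
  assumes fin: "finite \<Omega>"
    and amin: "is_arg_min (\<lambda>S. g S / real (card S)) (\<lambda>S. S \<noteq> {} \<and> S \<subseteq> \<Omega>) S\<^sub>0"
    and S: "S \<subseteq> \<Omega> - S\<^sub>0"
  shows "g S\<^sub>0 / real (card S\<^sub>0) * real (card S) \<le> g (S \<union> S\<^sub>0) - g S\<^sub>0"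
proof -
  let ?m = "g S\<^sub>0 / real (card S\<^sub>0)"
  note S0 = average_arg_minD[OF fin amin]
  have "finite S" "finite S\<^sub>0"
    using S S0(2) fin by (auto intro: finite_subset)
  then have "card (S \<union> S\<^sub>0) = card S + card S\<^sub>0"
    using S by (intro card_Un_disjoint) auto
  moreover have "?m * real (card (S \<union> S\<^sub>0)) \<le> g (S \<union> S\<^sub>0)"
    using S S0 by (intro S0(4)) auto
  ultimately have "?m * real (card S) + ?m * real (card S\<^sub>0) \<le> g (S \<union> S\<^sub>0)"
    by (simp only: of_nat_add distrib_left)
  moreover have "?m * real (card S\<^sub>0) = g S\<^sub>0"
    using S0(3) by simp
  ultimately show ?thesis
    by linarith
qed

text \<open>The bound \<open>c\<close> is general because it changes along the recursion: each
  recursive call is bounded by the preceding minimal average. Later, \<open>c = 0\<close> gives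
  nonnegativity.\<close>

lemma max_min_algorithm_ge:
  assumes "max_min_algorithm \<Omega> g r"
    and "\<And>S. S \<noteq> {} \<Longrightarrow> S \<subseteq> \<Omega> \<Longrightarrow> c * real (card S) \<le> g S"
    and "i \<in> \<Omega>"
  shows "c \<le> r i"
  using assms
proof (induction arbitrary: c i rule: max_min_algorithm.induct)
  case (stop \<Omega> g S\<^sub>0)
  note S0 = average_arg_minD[OF stop(1,2)]
  have "c * real (card S\<^sub>0) \<le> g S\<^sub>0"
    using stop.prems(1) S0(1,2) by blast
  then show ?case
    using S0(3) stop.prems(2) by (simp add: pos_le_divide_eq)
next
  case (recurse \<Omega> g S\<^sub>0 r')
  let ?m = "g S\<^sub>0 / real (card S\<^sub>0)"
  note S0 = average_arg_minD[OF recurse(1,2)]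
  have "c * real (card S\<^sub>0) \<le> g S\<^sub>0"
    using recurse.prems(1) S0(1,2) by blast
  then have "c \<le> ?m"
    using S0(3) by (simp add: pos_le_divide_eq)
  \<comment> \<open>The induction hypothesis is used with \<open>?m\<close> in place of
    \<open>c\<close>; its premise on the contracted function is
    \<open>contraction_ge\<close>.\<close>
  moreover have "?m \<le> r' i" if "i \<notin> S\<^sub>0"
    using recurse.IH[of ?m i] contraction_ge[OF recurse(1,2)] recurse.prems(2) that by blast
  ultimately show ?case
    using recurse.prems(2) by auto
qed

lemma max_min_algorithm_extensional:
  "max_min_algorithm \<Omega> g r \<Longrightarrow> r \<in> extensional \<Omega>"
  by (auto elim: max_min_algorithm.cases)

lemma max_min_algorithm_nonneg:
  assumes "max_min_algorithm \<Omega> g r" "\<And>S. S \<subseteq> \<Omega> \<Longrightarrow> 0 \<le> g S"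
  shows "r \<in> \<Omega> \<rightarrow>\<^sub>E {0..}"
  using max_min_algorithm_ge[OF assms(1), of 0] assms
    max_min_algorithm_extensional[OF assms(1)] by (auto simp: PiE_def)

lemma max_min_algorithm_fair:
  assumes "max_min_algorithm \<Omega> g r"
    and "\<And>S. S \<subseteq> \<Omega> \<Longrightarrow> 0 \<le> g S"
    and "\<And>S T. S \<subseteq> \<Omega> \<Longrightarrow> T \<subseteq> \<Omega> \<Longrightarrow> g (S \<inter> T) + g (S \<union> T) \<le> g S + g T"
  shows "max_min_fair \<Omega> (polyhedron \<Omega> g) r"
  using assms
proof (induction rule: max_min_algorithm.induct)
  case (stop \<Omega> g S\<^sub>0)
  let ?m = "g S\<^sub>0 / real (card S\<^sub>0)"
  let ?r = "\<lambda>i\<in>\<Omega>. ?m"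
  note S0 = average_arg_minD[OF stop(1,2)]
  have "sum ?r S \<le> g S" if "S \<subseteq> \<Omega>" for S
  \<comment> \<open>The minimum ranges over nonempty sets only; for the empty set the bound is
    \<open>0 \<le> g {}\<close>.\<close>
  proof (cases "S = {}")
    case True
    then show ?thesis
      using stop.prems(1) by simp
  next
    case False
    have "sum ?r S = ?m * real (card S)"
      using that by (simp add: subset_iff)
    then show ?thesis
      using S0(4)[OF False that] by simp
  qed
  moreover have "?r \<in> \<Omega> \<rightarrow>\<^sub>E {0..}"
    using max_min_algorithm.stop[OF stop(1-3)] stop.prems(1)
    by (rule max_min_algorithm_nonneg)
  moreover have "\<exists>j\<in>\<Omega>. q j < ?r j \<and> ?r j \<le> ?r i"
    if q: "q \<in> polyhedron \<Omega> g" and i: "i \<in> \<Omega>" "?r i < q i" for q i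
  proof (rule ccontr)
    assume "\<not> ?thesis"
    then have "\<And>j. j \<in> \<Omega> \<Longrightarrow> ?m \<le> q j"
      using i by force
    \<comment> \<open>No coordinate of \<open>q\<close> is below \<open>?m\<close> and coordinate
      \<open>i\<close> is above it, so \<open>q\<close> would violate the constraint at
      \<open>\<Omega>\<close>, where \<open>?m * card \<Omega> = g \<Omega>\<close>.\<close>
    then have "(\<Sum>j\<in>\<Omega>. ?m) < sum q \<Omega>"
      using i stop(1) by (intro sum_strict_mono_ex1) auto
    moreover have "sum q \<Omega> \<le> g \<Omega>"
      using q by (rule polyhedronD) simp
    ultimately show False
      using S0(3) stop(3) by simp
  qed
  ultimately show ?case
    by (auto simp: max_min_fair_def polyhedron_def)
next
  case (recurse \<Omega> g S\<^sub>0 r')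
  let ?m = "g S\<^sub>0 / real (card S\<^sub>0)"
  let ?g = "\<lambda>S. g (S \<union> S\<^sub>0) - g S\<^sub>0"
  let ?r = "\<lambda>i\<in>\<Omega>. if i \<in> S\<^sub>0 then ?m else r' i"
  note S0 = average_arg_minD[OF recurse(1,2)]
  have fin0: "finite S\<^sub>0"
    using S0(2) recurse(1) by (rule finite_subset)
  have m_sum: "(\<Sum>j\<in>S\<^sub>0. ?m) = g S\<^sub>0"
    using S0(3) by simp
  have m_le: "?m \<le> r' i" if "i \<in> \<Omega> - S\<^sub>0" for i
    by (rule max_min_algorithm_ge[OF recurse(4) contraction_ge[OF recurse(1,2)] that])
  have "0 \<le> ?m"
    using recurse.prems(1)[OF S0(2)] by simp
  have IH: "max_min_fair (\<Omega> - S\<^sub>0) (polyhedron (\<Omega> - S\<^sub>0) ?g) r'"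
  proof (rule recurse.IH)
    fix S assume "S \<subseteq> \<Omega> - S\<^sub>0"
    then show "0 \<le> ?g S"
      using contraction_ge[OF recurse(1,2), of S] \<open>0 \<le> ?m\<close>
        mult_nonneg_nonneg[of ?m "real (card S)"] by linarith
  next
    fix S T assume "S \<subseteq> \<Omega> - S\<^sub>0" "T \<subseteq> \<Omega> - S\<^sub>0"
    \<comment> \<open>Submodularity of the contraction is that of \<open>g\<close> at the sets
      enlarged by \<open>S\<^sub>0\<close>.\<close>
    then have "g ((S \<union> S\<^sub>0) \<inter> (T \<union> S\<^sub>0)) + g ((S \<union> S\<^sub>0) \<union> (T \<union> S\<^sub>0)) \<le> g (S \<union> S\<^sub>0) + g (T \<union> S\<^sub>0)"
      using S0(2) by (intro recurse.prems(2)) auto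
    moreover have "(S \<union> S\<^sub>0) \<inter> (T \<union> S\<^sub>0) = S \<inter> T \<union> S\<^sub>0" "(S \<union> S\<^sub>0) \<union> (T \<union> S\<^sub>0) = S \<union> T \<union> S\<^sub>0"
      by auto
    ultimately show "?g (S \<inter> T) + ?g (S \<union> T) \<le> ?g S + ?g T"
      by simp
  qed
  have "sum ?r S \<le> g S" if S: "S \<subseteq> \<Omega>" for S
  proof -
    have "finite S"
      using S recurse(1) by (rule finite_subset)
    then have "sum ?r S = sum ?r (S \<inter> S\<^sub>0) + sum ?r (S - S\<^sub>0)"
      by (rule sum.Int_Diff)
    also have "sum ?r (S \<inter> S\<^sub>0) = (\<Sum>i\<in>S \<inter> S\<^sub>0. ?m)"
      using S by (intro sum.cong) auto
    also have "\<dots> \<le> g (S \<inter> S\<^sub>0)"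
    proof (cases "S \<inter> S\<^sub>0 = {}")
      case True
      then show ?thesis
        using recurse.prems(1) by simp
    next
      case False
      then show ?thesis
        using S0(4)[OF False] S by (auto simp: mult.commute)
    qed
    also have "sum ?r (S - S\<^sub>0) = sum r' (S - S\<^sub>0)"
      using S by (intro sum.cong) auto
    also have "\<dots> \<le> ?g (S - S\<^sub>0)"
      using S by (intro polyhedronD[OF max_min_fair_mem[OF IH]]) auto
    \<comment> \<open>Submodularity at \<open>S\<close> and \<open>S\<^sub>0\<close>, since
      \<open>(S - S\<^sub>0) \<union> S\<^sub>0 = S \<union> S\<^sub>0\<close>.\<close>
    also have "g (S \<inter> S\<^sub>0) + ?g (S - S\<^sub>0) \<le> g S"
      using recurse.prems(2)[OF S S0(2)] by simp
    finally show ?thesis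
      by simp
  qed
  moreover have "?r \<in> \<Omega> \<rightarrow>\<^sub>E {0..}"
    using max_min_algorithm.recurse[OF recurse(1-4)] recurse.prems(1)
    by (rule max_min_algorithm_nonneg)
  moreover have "\<exists>j\<in>\<Omega>. q j < ?r j \<and> ?r j \<le> ?r i"
    if q: "q \<in> polyhedron \<Omega> g" and i: "i \<in> \<Omega>" "?r i < q i" for q i
  proof (cases "\<exists>j\<in>S\<^sub>0. q j < ?m")
    case True
    \<comment> \<open>Since \<open>?m\<close> is the least rate on all of \<open>\<Omega>\<close>,
      this \<open>j\<close> is a witness whether or not \<open>i\<close> lies in
      \<open>S\<^sub>0\<close>.\<close>
    then obtain j where "j \<in> S\<^sub>0" "q j < ?m"
      by blast
    then have "j \<in> \<Omega>" "q j < ?r j" "?r j \<le> ?r i"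
      using S0(2) i(1) m_le by auto
    then show ?thesis
      by blast
  next
    case False
    then have m_le_q: "?m \<le> q j" if "j \<in> S\<^sub>0" for j
      using that by force
    have "sum q S\<^sub>0 \<le> g S\<^sub>0"
      using q S0(2) by (rule polyhedronD)
    have "i \<notin> S\<^sub>0"
    proof
      assume "i \<in> S\<^sub>0"
      then have "(\<Sum>j\<in>S\<^sub>0. ?m) < sum q S\<^sub>0"
        using i m_le_q fin0 by (intro sum_strict_mono_ex1) auto
      then show False
        using m_sum \<open>sum q S\<^sub>0 \<le> g S\<^sub>0\<close> by linarith
    qed
    \<comment> \<open>With the constraint at \<open>S \<union> S\<^sub>0\<close>, this bounds
      \<open>sum q S\<close> by the contracted function.\<close>
    have "g S\<^sub>0 \<le> sum q S\<^sub>0"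
      using sum_mono[of S\<^sub>0 "\<lambda>_. ?m" q] m_le_q m_sum by simp
    have "sum q S \<le> ?g S" if S: "S \<subseteq> \<Omega> - S\<^sub>0" for S
    proof -
      have "sum q (S \<union> S\<^sub>0) = sum q S + sum q S\<^sub>0"
        using S recurse(1) fin0 by (intro sum.union_disjoint) (auto intro: finite_subset)
      moreover have "sum q (S \<union> S\<^sub>0) \<le> g (S \<union> S\<^sub>0)"
        using S S0(2) by (intro polyhedronD[OF q]) auto
      ultimately show ?thesis
        using \<open>g S\<^sub>0 \<le> sum q S\<^sub>0\<close> by linarith
    qed
    \<comment> \<open>Members of the contracted polyhedron are extensional, so \<open>q\<close> has
      to be restricted.\<close>
    moreover have "sum (restrict q (\<Omega> - S\<^sub>0)) S = sum q S" if "S \<subseteq> \<Omega> - S\<^sub>0" for S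
      using that by (intro sum.cong) auto
    ultimately have "restrict q (\<Omega> - S\<^sub>0) \<in> polyhedron (\<Omega> - S\<^sub>0) ?g"
      using q by (auto simp: polyhedron_def)
    moreover have "i \<in> \<Omega> - S\<^sub>0" "r' i < restrict q (\<Omega> - S\<^sub>0) i"
      using i \<open>i \<notin> S\<^sub>0\<close> by auto
    ultimately obtain j where "j \<in> \<Omega> - S\<^sub>0" "restrict q (\<Omega> - S\<^sub>0) j < r' j" "r' j \<le> r' i"
      using IH unfolding max_min_fair_def by blast
    \<comment> \<open>Both \<open>i\<close> and \<open>j\<close> lie outside
      \<open>S\<^sub>0\<close>, where \<open>?r\<close> agrees with \<open>r'\<close>.\<close>
    then show ?thesis
      using i(1) \<open>i \<notin> S\<^sub>0\<close> by (intro bexI[of _ j]) auto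
  qed
  ultimately show ?case
    unfolding max_min_fair_def polyhedron_def by blast
qed

theorem theorem20:
  fixes K :: nat and g :: "nat set \<Rightarrow> real" and r :: "nat \<Rightarrow> real"
  assumes "K \<ge> 1"
    and "\<And>S. S \<subseteq> {1..K} \<Longrightarrow> g S \<ge> 0"
    and "\<And>S T. S \<subseteq> {1..K} \<Longrightarrow> T \<subseteq> {1..K} \<Longrightarrow> g S + g T \<ge> g (S \<inter> T) + g (S \<union> T)"
    and "max_min_algorithm {1..K} g r"
  shows "max_min_fair {1..K} (polyhedron {1..K} g) r \<and>
    (\<forall>q. max_min_fair {1..K} (polyhedron {1..K} g) q \<longrightarrow> q = r)"
proof -
  have "max_min_fair {1..K} (polyhedron {1..K} g) r"
    using assms by (intro max_min_algorithm_fair)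
  moreover have "polyhedron {1..K} g \<subseteq> extensional {1..K}"
    by (auto simp: polyhedron_def PiE_def)
  ultimately show ?thesis
    using max_min_fair_unique[of "{1..K}" "polyhedron {1..K} g"] by blast
qed

end
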